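(* Set a step size $h>0$ and a time-scaling $\varepsilon>0$, and let $\gamma=h/\varepsilon$. Let $g:W\to\mathbb R\cup\{+\infty\}$ be a proper, convex, lower semicontinuous function and $\mathcal S=\partial g$. Let $\psi_h^{1e},\psi_h^{1i}$ be the explicit and implicit Euler steps of size $h$ for $\varepsilon\dot w_1=-\mathcal Aw_1-b$, and $\psi_h^{2e},\psi_h^{2i}$ the explicit and implicit Euler steps of size $h$ for $\varepsilon\dot w_2\in-\mathcal Sw_2$. Then $$(\psi_h^{2e}\circ\psi_h^{2i}\circ\psi_h^{1e}\circ\psi_h^{1i})(w)=(R_{\gamma\mathcal S}\circ R_{\gamma(\mathcal A+b)})(w)\qquad\text{for all } w\in W .$$ Hence, for an initial value $w_0\in W$, the sequences $(w_n)_{n\in\mathbb N}$ produced by the update rules (i) $w_{n+1}=(\psi_h^{2e}\circ\psi_h^{2i}\circ\psi_h^{1e}\circ\psi_h^{1i})(w_n)$; (ii) $w_{n+1}=(R_{\gamma\mathcal S}\circ R_{\gamma(\mathcal A+b)})(w_n)$ coincide.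
   Context: $W$ is a Hilbert space, $\mathcal A:W\supset D(\mathcal A)\to W$ is a single-valued maximally monotone operator, and $b\in W$ is a given forcing term; $\mathcal A+b$ denotes the operator $w\mapsto\mathcal A(w)+b$. $\partial g$ denotes the convex subdifferential of $g$. For $\mathcal M:W\rightrightarrows W$ and $\gamma>0$, the resolvent is $J_{\gamma\mathcal M}=(I+\gamma\mathcal M)^{-1}$ and the reflected resolvent is $R_{\gamma\mathcal M}=2J_{\gamma\mathcal M}-I$. For $\varepsilon\dot w\in-\mathcal M(w)$, the explicit Euler step of size $h$ is $I-\frac h\varepsilon\mathcal M$, i.e. $w\mapsto w-\frac h\varepsilon\mathcal M(w)$, and the implicit Euler step of size $h$ is $J_{\frac h\varepsilon\mathcal M}=(I+\frac h\varepsilon\mathcal M)^{-1}$.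
   Formalization: For multivalued S the displayed identity fails (W=ℝ, A=b=0, g=|·|, γ=1, w=0: [−1,1] vs {0}); the explicit step of S reuses the subgradient found by its implicit step; the literal composition is proved equal if S is at most single-valued, and in general contains the right-hand side. *)

theory Defs
  imports "HOL-Analysis.Analysis"
begin

text \<open>
  An operator \<open>W \<rightrightarrows> W\<close> is a function \<open>'w \<Rightarrow> 'w set\<close>; its domain is the set of points with a
  nonempty value. A map on \<open>W\<close> is an operator with singleton values.
\<close>

definition op_on :: "'w set \<Rightarrow> ('w \<Rightarrow> 'w) \<Rightarrow> 'w \<Rightarrow> 'w set" where
  "op_on D f x = (if x \<in> D then {f x} else {})"

definition op_comp :: "('w \<Rightarrow> 'w set) \<Rightarrow> ('w \<Rightarrow> 'w set) \<Rightarrow> 'w \<Rightarrow> 'w set"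
    (infixr "\<circ>\<^sub>s" 55) where
  "(F \<circ>\<^sub>s G) x = (\<Union>y\<in>G x. F y)"

definition op_inverse :: "('w \<Rightarrow> 'w set) \<Rightarrow> 'w \<Rightarrow> 'w set" where
  "op_inverse F y = {x. y \<in> F x}"

definition at_most_single_valued :: "('w \<Rightarrow> 'w set) \<Rightarrow> bool" where
  "at_most_single_valued M \<longleftrightarrow> (\<forall>x. \<forall>u\<in>M x. \<forall>v\<in>M x. u = v)"

definition monotone_op :: "('w::real_inner \<Rightarrow> 'w set) \<Rightarrow> bool" where
  "monotone_op M \<longleftrightarrow> (\<forall>x y. \<forall>u\<in>M x. \<forall>v\<in>M y. 0 \<le> (u - v) \<bullet> (x - y))"

definition maximally_monotone :: "('w::real_inner \<Rightarrow> 'w set) \<Rightarrow> bool" where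
  "maximally_monotone M \<longleftrightarrow>
     monotone_op M \<and> (\<forall>N. monotone_op N \<and> (\<forall>x. M x \<subseteq> N x) \<longrightarrow> N = M)"

definition resolvent :: "real \<Rightarrow> ('w::real_vector \<Rightarrow> 'w set) \<Rightarrow> 'w \<Rightarrow> 'w set" where
  "resolvent \<gamma> M = op_inverse (\<lambda>x. {x + \<gamma> *\<^sub>R u | u. u \<in> M x})"

definition reflected_resolvent :: "real \<Rightarrow> ('w::real_vector \<Rightarrow> 'w set) \<Rightarrow> 'w \<Rightarrow> 'w set" where
  "reflected_resolvent \<gamma> M w = {2 *\<^sub>R z - w | z. z \<in> resolvent \<gamma> M w}"

definition expl_euler :: "real \<Rightarrow> real \<Rightarrow> ('w::real_vector \<Rightarrow> 'w set) \<Rightarrow> 'w \<Rightarrow> 'w set" where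
  "expl_euler h \<epsilon> M w = {w - (h / \<epsilon>) *\<^sub>R u | u. u \<in> M w}"

definition impl_euler :: "real \<Rightarrow> real \<Rightarrow> ('w::real_vector \<Rightarrow> 'w set) \<Rightarrow> 'w \<Rightarrow> 'w set" where
  "impl_euler h \<epsilon> M = resolvent (h / \<epsilon>) M"

text \<open>
  The composition ``explicit after implicit Euler step'' for a multivalued \<open>M\<close>: the implicit step
  \<open>z = w - (h/\<epsilon>) u\<close> determines an element \<open>u \<in> M z\<close>, and the explicit step leaving \<open>z\<close> evaluates
  \<open>M\<close> at \<open>z\<close> by this same element. The unrestricted composition
  \<open>expl_euler h \<epsilon> M \<circ>\<^sub>s impl_euler h \<epsilon> M\<close> instead allows any element of \<open>M z\<close> in the explicit step,
  so it is multivalued in general (e.g. for \<open>M = \<partial>|\<cdot>|\<close> on the reals at \<open>w = 0\<close>). The two agree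
  if \<open>M\<close> is at most single-valued.
\<close>

definition expl_impl_euler :: "real \<Rightarrow> real \<Rightarrow> ('w::real_vector \<Rightarrow> 'w set) \<Rightarrow> 'w \<Rightarrow> 'w set" where
  "expl_impl_euler h \<epsilon> M w =
     {v. \<exists>z\<in>impl_euler h \<epsilon> M w. \<exists>u\<in>M z. z = w - (h / \<epsilon>) *\<^sub>R u \<and> v = z - (h / \<epsilon>) *\<^sub>R u}"

definition proper_fun :: "('w \<Rightarrow> ereal) \<Rightarrow> bool" where
  "proper_fun g \<longleftrightarrow> (\<forall>x. g x \<noteq> -\<infinity>) \<and> (\<exists>x. g x \<noteq> \<infinity>)"

text \<open>Intended for functions without the value \<open>-\<infinity>\<close>, so that the right-hand side is never \<open>\<infinity> - \<infinity>\<close>.\<close>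

definition convex_fun :: "('w::real_vector \<Rightarrow> ereal) \<Rightarrow> bool" where
  "convex_fun g \<longleftrightarrow> (\<forall>x y. \<forall>t\<in>{0<..<1::real}.
     g ((1 - t) *\<^sub>R x + t *\<^sub>R y) \<le> ereal (1 - t) * g x + ereal t * g y)"

definition lower_semicontinuous :: "('w::topological_space \<Rightarrow> ereal) \<Rightarrow> bool" where
  "lower_semicontinuous g \<longleftrightarrow> (\<forall>x. g x \<le> Liminf (nhds x) g)"

text \<open>For proper \<open>g\<close> this is automatically empty where \<open>g x = \<infinity>\<close>.\<close>

definition subdifferential :: "('w::real_inner \<Rightarrow> ereal) \<Rightarrow> 'w \<Rightarrow> 'w set" where
  "subdifferential g x = {u. \<forall>y. g x + ereal (u \<bullet> (y - x)) \<le> g y}"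

definition update_sequences :: "('w \<Rightarrow> 'w set) \<Rightarrow> 'w \<Rightarrow> (nat \<Rightarrow> 'w) set" where
  "update_sequences F w0 = {w. w 0 = w0 \<and> (\<forall>n. w (Suc n) \<in> F (w n))}"

end

theory Submission
  imports Defs
begin

text \<open>
  The implicit Euler step from \<open>w\<close> lands at a point \<open>z\<close> with \<open>w = z + \<gamma> u\<close> for some \<open>u\<close> in \<open>M z\<close>.
  An explicit step from \<open>z\<close> along this same \<open>u\<close> ends at \<open>z - \<gamma> u = z - (w - z) = 2 z - w\<close>, which is
  the reflection of \<open>w\<close> at its resolvent. This computation gives the equality of the two operators;
  for a multivalued \<open>M\<close> the explicit step has to reuse the direction of the implicit one, whereas
  for a single-valued \<open>M\<close> there is no other direction
  (\<open>expl_impl_euler_eq_reflected_resolvent\<close>, \<open>euler_comp_single_valued\<close>).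

  The analytic content is that both reflected resolvents have exactly one value at every point, so
  that there is exactly one sequence of iterates. Monotonicity gives uniqueness
  (\<open>reflected_resolvent_singleton\<close>). Existence means that \<open>I + \<gamma> M\<close> is onto. For \<open>M = \<partial>g\<close> it is
  obtained by minimizing \<open>g + |\<cdot> - w|\<^sup>2 / (2 \<gamma>)\<close> (\<open>resolvent_subdifferential_nonempty\<close>). For a maximally
  monotone \<open>M\<close> it is Minty's theorem (\<open>minty\<close>), which is reduced to the case of a subdifferential: the
  Fitzpatrick function of the graph of \<open>M\<close> is convex and lower semicontinuous on the product space,
  and its proximal point at the origin provides the required element of the graph. Adding the
  forcing term \<open>b\<close> to an operator only replaces \<open>w\<close> by \<open>w - \<gamma> b\<close> in the equation to be solved.
\<close>

section \<open>Proximal points of convex functions\<close>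

lemma lower_semicontinuous_eventually_gt:
  assumes "lower_semicontinuous g" "c < g x"
  shows "\<forall>\<^sub>F y in nhds x. c < g y"
  using assms less_LiminfD unfolding lower_semicontinuous_def
  by (metis order_less_le_trans)

text \<open>Passage from the extended real inequality of convexity to real numbers.\<close>

lemma convex_fun_finite:
  fixes g :: "'a::real_vector \<Rightarrow> ereal"
  assumes "proper_fun g" "convex_fun g"
    and "g x = ereal a" "g y = ereal b" "0 < t" "t < 1"
  obtains c where "g ((1 - t) *\<^sub>R x + t *\<^sub>R y) = ereal c" "c \<le> (1 - t) * a + t * b"
proof -
  let ?p = "(1 - t) *\<^sub>R x + t *\<^sub>R y"
  have "g ?p \<le> ereal ((1 - t) * a + t * b)"
    using assms(2-) unfolding convex_fun_def
    by (metis greaterThanLessThan_iff plus_ereal.simps(1) times_ereal.simps(1))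
  moreover have "g ?p \<noteq> -\<infinity>"
    using assms(1) by (auto simp: proper_fun_def)
  ultimately show thesis
    using that by (cases "g ?p") auto
qed

text \<open>
  Lower semicontinuity bounds \<open>g\<close> from below on a small ball around a point \<open>x0\<close> where it is finite.
  On a segment leaving that ball, convexity forbids \<open>g\<close> to decrease faster than it can have decreased
  inside, so \<open>g\<close> is bounded below by a cone. The slope \<open>m\<close> may be arbitrary because a
  quadratic term dominates the cone in the minimization problem below.
\<close>

lemma convex_lsc_cone_minorant:
  fixes g :: "'a::real_inner \<Rightarrow> ereal"
  assumes "proper_fun g" "convex_fun g" "lower_semicontinuous g"
  obtains c m where "\<And>x. ereal (c - m * norm (x - w)) \<le> g x"
proof -
  obtain x0 a where a: "g x0 = ereal a"
    using assms(1) unfolding proper_fun_def by (metis ereal_cases)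
  have "ereal (a - 1) < g x0"
    by (simp add: a)
  from lower_semicontinuous_eventually_gt[OF assms(3) this]
  obtain r where r: "r > 0" and below: "\<And>x. dist x x0 < r \<Longrightarrow> ereal (a - 1) < g x"
    unfolding eventually_nhds_metric by blast
  have bound: "a - 1 - 2 / r * norm (x - x0) \<le> v" if v: "g x = ereal v" for x v
  proof (cases "norm (x - x0) < r")
    case True
    then have "a - 1 < v"
      using below[of x] v by (simp add: dist_norm)
    moreover have "0 \<le> 2 / r * norm (x - x0)"
      using r by simp
    ultimately show ?thesis by linarith
  next
    case False
    define s where "s = norm (x - x0)"
    \<comment> \<open>The point at parameter \<open>t\<close> of the segment from \<open>x0\<close> to \<open>x\<close> has distance \<open>r / 2\<close> from \<open>x0\<close>.\<close>
    define t where "t = r / (2 * s)"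
    have s: "s \<ge> r" using False by (simp add: s_def)
    have t: "0 < t" "t < 1" using r s by (auto simp: t_def)
    obtain e where e: "g ((1 - t) *\<^sub>R x0 + t *\<^sub>R x) = ereal e" "e \<le> (1 - t) * a + t * v"
      using convex_fun_finite[OF assms(1,2) a v t] by blast
    have "((1 - t) *\<^sub>R x0 + t *\<^sub>R x) - x0 = t *\<^sub>R (x - x0)"
      by (simp add: algebra_simps)
    then have "dist ((1 - t) *\<^sub>R x0 + t *\<^sub>R x) x0 = t * s"
      using t by (simp add: dist_norm s_def)
    also have "\<dots> < r"
      using r s by (simp add: t_def)
    finally have "a - 1 < e"
      using below e(1) by fastforce
    with e(2) have "t * (a - v) < 1"
      by (simp add: algebra_simps)
    then have "a - v < 1 / t"
      using t by (simp add: pos_less_divide_eq mult.commute)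
    then show ?thesis
      using r s by (simp add: t_def s_def)
  qed
  have "ereal (a - 1 - 2 / r * norm (w - x0) - 2 / r * norm (x - w)) \<le> g x" for x
  proof (cases "g x")
    case (real v)
    have "norm (x - x0) \<le> norm (x - w) + norm (w - x0)"
      by norm
    then have "2 / r * norm (x - x0) \<le> 2 / r * (norm (x - w) + norm (w - x0))"
      using r by (intro mult_left_mono) auto
    then show ?thesis
      using bound[OF real] by (simp add: real distrib_left)
  qed (use assms(1) in \<open>auto simp: proper_fun_def\<close>)
  then show thesis
    by (rule that)
qed

text \<open>
  The quadratic term makes the objective strongly convex: by the parallelogram law, its value at a
  midpoint is below the average of the values by \<open>|x - y|\<^sup>2 / (8 \<gamma>)\<close>. Hence a minimizing sequence is
  Cauchy, and lower semicontinuity shows that its limit is a minimizer.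
\<close>

lemma proximal_point_exists:
  fixes g :: "'a::{real_inner,complete_space} \<Rightarrow> ereal"
  assumes "proper_fun g" "convex_fun g" "lower_semicontinuous g" "\<gamma> > 0"
  obtains z where
    "\<And>x. g z + ereal ((norm (z - w))\<^sup>2 / (2 * \<gamma>)) \<le> g x + ereal ((norm (x - w))\<^sup>2 / (2 * \<gamma>))"
proof -
  define q where "q x = (norm (x - w))\<^sup>2 / (2 * \<gamma>)" for x
  define V where "V = {v + q x |x v. g x = ereal v}"
  define I where "I = Inf V"
  obtain c m where cm: "\<And>x. ereal (c - m * norm (x - w)) \<le> g x"
    using convex_lsc_cone_minorant[OF assms(1-3)] by blast
  obtain x0 v0 where "g x0 = ereal v0"
    using assms(1) unfolding proper_fun_def by (metis ereal_cases)
  then have V_ne: "V \<noteq> {}"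
    by (auto simp: V_def)
  have V_bdd: "bdd_below V"
  proof (rule bdd_belowI)
    fix s assume "s \<in> V"
    then obtain x v where x: "g x = ereal v" "s = v + q x"
      by (auto simp: V_def)
    \<comment> \<open>Completing the square absorbs the cone minorant into the quadratic term.\<close>
    have "0 \<le> (norm (x - w) - \<gamma> * m)\<^sup>2 / (2 * \<gamma>)"
      using assms(4) by simp
    also have "\<dots> = q x - m * norm (x - w) + \<gamma> * m\<^sup>2 / 2"
      using assms(4) by (simp add: q_def field_simps power2_eq_square)
    finally show "c - \<gamma> * m\<^sup>2 / 2 \<le> s"
      using cm[of x] x by simp
  qed
  have I_le: "I \<le> v + q x" if "g x = ereal v" for x v
    unfolding I_def by (rule cInf_lower[OF _ V_bdd]) (use that in \<open>auto simp: V_def\<close>)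
  have "\<exists>x v. g x = ereal v \<and> v + q x < I + 1 / real (Suc n)" for n
    using cInf_lessD[OF V_ne, of "I + 1 / real (Suc n)"] by (auto simp: I_def V_def)
  then obtain X F where F: "\<And>n. g (X n) = ereal (F n)"
    and X: "\<And>n. F n + q (X n) < I + 1 / real (Suc n)"
    by metis
  have close: "(dist (X i) (X j))\<^sup>2 \<le> 4 * \<gamma> * (1 / real (Suc i) + 1 / real (Suc j))" for i j
  proof -
    \<comment> \<open>The midpoint cannot beat the infimum, which bounds the gain from strong convexity.\<close>
    let ?p = "(1 - 1/2) *\<^sub>R X i + (1/2) *\<^sub>R X j"
    obtain e where e: "g ?p = ereal e" "e \<le> (1 - 1/2) * F i + 1/2 * F j"
      using convex_fun_finite[OF assms(1,2) F F, of "1/2" i j] by auto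
    have "(norm (?p - w))\<^sup>2 = (norm (X i - w))\<^sup>2 / 2 + (norm (X j - w))\<^sup>2 / 2 - (dist (X i) (X j))\<^sup>2 / 4"
      unfolding dist_norm power2_norm_eq_inner
      by (simp add: inner_diff inner_add inner_commute field_simps)
    then have "q ?p = q (X i) / 2 + q (X j) / 2 - (dist (X i) (X j))\<^sup>2 / (8 * \<gamma>)"
      by (simp add: q_def add_divide_distrib diff_divide_distrib)
    then have "(dist (X i) (X j))\<^sup>2 / (8 * \<gamma>) \<le> (1 / real (Suc i) + 1 / real (Suc j)) / 2"
      using I_le[OF e(1)] e(2) X[of i] X[of j] by simp
    then show ?thesis
      using assms(4) by (simp add: divide_le_eq mult_ac)
  qed
  have "Cauchy X"
  proof (rule metric_CauchyI)
    fix e :: real assume e: "e > 0"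
    obtain N where N: "8 * \<gamma> / e\<^sup>2 < real N"
      using reals_Archimedean2 by blast
    have "dist (X i) (X j) < e" if "i \<ge> N" "j \<ge> N" for i j
    proof -
      have "1 / real (Suc i) \<le> 1 / real (Suc N)" "1 / real (Suc j) \<le> 1 / real (Suc N)"
        using that by (auto intro!: divide_left_mono)
      then have "1 / real (Suc i) + 1 / real (Suc j) \<le> 2 / real (Suc N)"
        by simp
      then have "4 * \<gamma> * (1 / real (Suc i) + 1 / real (Suc j)) \<le> 4 * \<gamma> * (2 / real (Suc N))"
        using assms(4) by (intro mult_left_mono) auto
      also have "\<dots> < e\<^sup>2"
        using N e by (simp add: field_simps)
          (smt (verit) zero_less_power)
      finally have "(dist (X i) (X j))\<^sup>2 < e\<^sup>2"
        using close[of i j] by linarith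
      then show ?thesis
        using e by (simp add: power_less_imp_less_base)
    qed
    then show "\<exists>M. \<forall>m\<ge>M. \<forall>n\<ge>M. dist (X m) (X n) < e" by blast
  qed
  then obtain z where z: "X \<longlonglongrightarrow> z"
    using Cauchy_convergent convergent_def by blast
  have lim: "(\<lambda>n. I + 1 / real (Suc n) - q (X n)) \<longlonglongrightarrow> I + 0 - q z"
    unfolding q_def using assms(4)
    by (intro tendsto_intros z LIMSEQ_inverse_real_of_nat[unfolded inverse_eq_divide]) auto
  have "g z \<le> ereal (I - q z)"
  proof (rule ccontr)
    assume "\<not> ?thesis"
    then have "ereal (I - q z) < g z"
      by (simp add: not_le)
    from ereal_dense2[OF this]
    obtain c' where c': "ereal (I - q z) < ereal c'" "ereal c' < g z"
      by blast
    have "\<forall>\<^sub>F n in sequentially. ereal c' < g (X n)"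
      using lower_semicontinuous_eventually_gt[OF assms(3) c'(2)] z
      by (rule eventually_compose_filterlim)
    then have "\<forall>\<^sub>F n in sequentially. c' \<le> I + 1 / real (Suc n) - q (X n)"
      by eventually_elim (use F X in \<open>smt (verit) less_ereal.simps(1)\<close>)
    then have "c' \<le> I + 0 - q z"
      using tendsto_lowerbound[OF lim] by simp
    then show False using c'(1) by simp
  qed
  then have le_I: "g z + ereal (q z) \<le> ereal I"
    by (cases "g z") auto
  have "g z + ereal (q z) \<le> g x + ereal (q x)" for x
  proof (cases "g x")
    case (real v)
    then show ?thesis using I_le[OF real] le_I by (simp add: order_trans)
  qed (use assms(1) in \<open>auto simp: proper_fun_def\<close>)
  then show thesis
    by (intro that[of z]) (simp add: q_def)
qed

lemma subdifferential_finite: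
  assumes "proper_fun g" "u \<in> subdifferential g x"
  obtains a where "g x = ereal a"
proof -
  obtain y where "g y \<noteq> \<infinity>"
    using assms(1) by (auto simp: proper_fun_def)
  moreover have "g x + ereal (u \<bullet> (y - x)) \<le> g y" "g x \<noteq> -\<infinity>"
    using assms by (auto simp: subdifferential_def proper_fun_def)
  ultimately show thesis
    using that by (cases "g x") auto
qed

lemma monotone_subdifferential:
  assumes "proper_fun g"
  shows "monotone_op (subdifferential g)"
  unfolding monotone_op_def
proof (intro allI ballI)
  fix x y u v assume uv: "u \<in> subdifferential g x" "v \<in> subdifferential g y"
  obtain a where a: "g x = ereal a" using subdifferential_finite[OF assms uv(1)] .
  obtain b where b: "g y = ereal b" using subdifferential_finite[OF assms uv(2)] .
  have "a + u \<bullet> (y - x) \<le> b" "b + v \<bullet> (x - y) \<le> a"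
    using uv a b by (auto simp: subdifferential_def dest: spec[of _ x] spec[of _ y])
  then show "0 \<le> (u - v) \<bullet> (x - y)"
    by (simp add: inner_diff)
qed

text \<open>
  First-order optimality at the proximal point \<open>z\<close>: the difference quotient of the objective towards
  any \<open>y\<close> is nonnegative, and as the step \<open>t\<close> tends to \<open>0\<close> the quadratic term contributes only its
  derivative, so that \<open>(w - z) / \<gamma>\<close> is a subgradient of \<open>g\<close> at \<open>z\<close>.
\<close>

lemma resolvent_subdifferential_nonempty:
  fixes g :: "'a::{real_inner,complete_space} \<Rightarrow> ereal"
  assumes "proper_fun g" "convex_fun g" "lower_semicontinuous g" "\<gamma> > 0"
  shows "\<exists>z. \<exists>u\<in>subdifferential g z. w = z + \<gamma> *\<^sub>R u"
proof -
  obtain z where z: "\<And>x. g z + ereal ((norm (z - w))\<^sup>2 / (2 * \<gamma>))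
      \<le> g x + ereal ((norm (x - w))\<^sup>2 / (2 * \<gamma>))"
    using proximal_point_exists[OF assms] by blast
  define u where "u = (1 / \<gamma>) *\<^sub>R (w - z)"
  obtain x0 where "g x0 \<noteq> \<infinity>"
    using assms(1) by (auto simp: proper_fun_def)
  with z[of x0] assms(1) obtain a where a: "g z = ereal a"
    by (cases "g z") (auto simp: proper_fun_def)
  have "g z + ereal (u \<bullet> (y - z)) \<le> g y" for y
  proof (cases "g y")
    case (real b)
    define k where "k = (norm (y - z))\<^sup>2 / (2 * \<gamma>)"
    have "0 \<le> b - a - u \<bullet> (y - z) + t * k" if t: "0 < t" "t < 1" for t
    proof -
      let ?p = "(1 - t) *\<^sub>R z + t *\<^sub>R y"
      obtain e where e: "g ?p = ereal e" "e \<le> (1 - t) * a + t * b"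
        using convex_fun_finite[OF assms(1,2) a real t] by blast
      have "?p - w = (z - w) + t *\<^sub>R (y - z)"
        by (simp add: algebra_simps)
      then have "(norm (?p - w))\<^sup>2
          = (norm (z - w))\<^sup>2 - 2 * t * ((w - z) \<bullet> (y - z)) + t\<^sup>2 * (norm (y - z))\<^sup>2"
        unfolding power2_norm_eq_inner
        by (simp add: inner_diff inner_add inner_commute algebra_simps power2_eq_square)
      then have "(norm (?p - w))\<^sup>2 / (2 * \<gamma>)
          = (norm (z - w))\<^sup>2 / (2 * \<gamma>) - t * (u \<bullet> (y - z)) + t\<^sup>2 * k"
        using assms(4) by (simp add: u_def k_def add_divide_distrib diff_divide_distrib)
      then have "0 \<le> t * (b - a - u \<bullet> (y - z) + t * k)"
        using z[of ?p] e a by (simp add: algebra_simps power2_eq_square)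
      then show ?thesis
        using t by (simp add: zero_le_mult_iff)
    qed
    then have "\<forall>\<^sub>F t in at_right 0. 0 \<le> b - a - u \<bullet> (y - z) + t * k"
      by (intro eventually_at_rightI[of 0 1]) auto
    moreover have "((\<lambda>t. b - a - u \<bullet> (y - z) + t * k) \<longlongrightarrow> b - a - u \<bullet> (y - z) + 0 * k) (at_right 0)"
      by (intro tendsto_intros)
    ultimately have "0 \<le> b - a - u \<bullet> (y - z) + 0 * k"
      by (intro tendsto_lowerbound) auto
    then show ?thesis by (simp add: a real)
  qed (use assms(1) in \<open>auto simp: proper_fun_def\<close>)
  then have "u \<in> subdifferential g z"
    by (simp add: subdifferential_def)
  moreover have "w = z + \<gamma> *\<^sub>R u"
    using assms(4) by (simp add: u_def)
  ultimately show ?thesis by blast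
qed

section \<open>Minty's theorem\<close>

text \<open>
  Adding \<open>(x, u)\<close> to the graph would preserve monotonicity. Maximality is used below only in this
  form, as a statement about pairs.
\<close>

lemma maximally_monotone_memberI:
  assumes max: "maximally_monotone M"
    and rel: "\<And>y v. v \<in> M y \<Longrightarrow> 0 \<le> (u - v) \<bullet> (x - y)"
  shows "u \<in> M x"
proof -
  define N where "N y = (if y = x then insert u (M y) else M y)" for y
  have "0 \<le> (v - u) \<bullet> (y - x)" if "v \<in> M y" for y v
    using rel[OF that] by (simp add: inner_diff)
  then have "monotone_op N"
    using max rel unfolding maximally_monotone_def monotone_op_def N_def by auto
  moreover have "\<forall>y. M y \<subseteq> N y"
    by (auto simp: N_def)
  ultimately have "N = M"
    using max by (auto simp: maximally_monotone_def)
  then show ?thesis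
    by (metis N_def insertI1)
qed

text \<open>
  The Fitzpatrick function of a graph. Subtracting \<open>x \<bullet> u\<close> from its value at \<open>(x, u)\<close> leaves the
  supremum of \<open>- (u - v) \<bullet> (x - y)\<close> over \<open>(y, v)\<close> in the graph, which measures how far \<open>(x, u)\<close> is
  from being monotonically related to the graph.
\<close>

definition fitzpatrick :: "('a \<times> 'a::real_inner) set \<Rightarrow> 'a \<times> 'a \<Rightarrow> ereal" where
  "fitzpatrick G p = (SUP (y, v)\<in>G. ereal (fst p \<bullet> v + y \<bullet> snd p - y \<bullet> v))"

lemma fitzpatrick_upper:
  "(y, v) \<in> G \<Longrightarrow> ereal (x \<bullet> v + y \<bullet> u - y \<bullet> v) \<le> fitzpatrick G (x, u)"
  unfolding fitzpatrick_def by (rule SUP_upper2) auto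

lemma fitzpatrick_le_iff:
  "fitzpatrick G (x, u) \<le> c \<longleftrightarrow> (\<forall>(y, v)\<in>G. ereal (x \<bullet> v + y \<bullet> u - y \<bullet> v) \<le> c)"
  unfolding fitzpatrick_def SUP_le_iff by auto

lemma fitzpatrick_on_graph:
  assumes "\<And>x u y v. (x, u) \<in> G \<Longrightarrow> (y, v) \<in> G \<Longrightarrow> 0 \<le> (u - v) \<bullet> (x - y)" and "(x, u) \<in> G"
  shows "fitzpatrick G (x, u) \<le> ereal (x \<bullet> u)"
  unfolding fitzpatrick_le_iff using assms(1)[OF assms(2)]
  by (fastforce simp: inner_diff inner_commute)

lemma convex_fitzpatrick: "convex_fun (fitzpatrick G)"
  unfolding convex_fun_def
proof (intro allI ballI)
  fix p q :: "'a \<times> 'a" and t :: real assume t: "t \<in> {0<..<1}"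
  obtain x u x' u' where p: "p = (x, u)" "q = (x', u')"
    by (metis surj_pair)
  have "ereal (((1 - t) *\<^sub>R x + t *\<^sub>R x') \<bullet> v + y \<bullet> ((1 - t) *\<^sub>R u + t *\<^sub>R u') - y \<bullet> v)
      \<le> ereal (1 - t) * fitzpatrick G p + ereal t * fitzpatrick G q" if "(y, v) \<in> G" for y v
  proof -
    have "((1 - t) *\<^sub>R x + t *\<^sub>R x') \<bullet> v + y \<bullet> ((1 - t) *\<^sub>R u + t *\<^sub>R u') - y \<bullet> v
        = (1 - t) * (x \<bullet> v + y \<bullet> u - y \<bullet> v) + t * (x' \<bullet> v + y \<bullet> u' - y \<bullet> v)"
      by (simp add: inner_add algebra_simps)
    also have "ereal \<dots> = ereal (1 - t) * ereal (x \<bullet> v + y \<bullet> u - y \<bullet> v)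
        + ereal t * ereal (x' \<bullet> v + y \<bullet> u' - y \<bullet> v)"
      by simp
    also have "\<dots> \<le> ereal (1 - t) * fitzpatrick G p + ereal t * fitzpatrick G q"
      unfolding p using t that by (intro add_mono ereal_mult_left_mono fitzpatrick_upper) auto
    finally show ?thesis .
  qed
  then show "fitzpatrick G ((1 - t) *\<^sub>R p + t *\<^sub>R q)
      \<le> ereal (1 - t) * fitzpatrick G p + ereal t * fitzpatrick G q"
    by (auto simp: p fitzpatrick_le_iff)
qed

lemma lower_semicontinuous_fitzpatrick: "lower_semicontinuous (fitzpatrick G)"
  unfolding lower_semicontinuous_def le_Liminf_iff
proof (intro allI impI)
  fix p :: "'a \<times> 'a" and c assume "c < fitzpatrick G p"
  then obtain y v where yv: "(y, v) \<in> G" "c < ereal (fst p \<bullet> v + y \<bullet> snd p - y \<bullet> v)"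
    by (auto simp: fitzpatrick_def less_SUP_iff)
  have "((\<lambda>p. ereal (fst p \<bullet> v + y \<bullet> snd p - y \<bullet> v))
      \<longlongrightarrow> ereal (fst p \<bullet> v + y \<bullet> snd p - y \<bullet> v)) (nhds p)"
    by (intro tendsto_intros filterlim_ident)
  from order_tendstoD(1)[OF this yv(2)]
  show "\<forall>\<^sub>F p in nhds p. c < fitzpatrick G p"
    by eventually_elim
      (metis fitzpatrick_upper[OF yv(1)] order_less_le_trans prod.collapse)
qed

text \<open>
  For a maximally monotone graph \<open>G\<close> the Fitzpatrick function \<open>F\<close> satisfies \<open>F (x, u) \<ge> x \<bullet> u\<close>
  everywhere, with equality on \<open>G\<close>. Its proximal point \<open>(x, u)\<close> at the origin has the subgradient
  \<open>(- x, - u)\<close>. The subgradient inequality at the points of \<open>G\<close>, with the two properties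
  of \<open>F\<close>, rearranges to \<open>|x + u|\<^sup>2 \<le> (- x - v) \<bullet> (- u - y)\<close> for all \<open>(y, v) \<in> G\<close>. So \<open>(- u, - x)\<close> is
  monotonically related to \<open>G\<close> and belongs to it by maximality. The same inequality at
  \<open>(y, v) = (- u, - x)\<close> then gives \<open>u = - x\<close>.
\<close>

lemma minty_graph:
  fixes G :: "('a \<times> 'a::{real_inner,complete_space}) set"
  assumes mono: "\<And>x u y v. (x, u) \<in> G \<Longrightarrow> (y, v) \<in> G \<Longrightarrow> 0 \<le> (u - v) \<bullet> (x - y)"
    and max: "\<And>x u. (\<And>y v. (y, v) \<in> G \<Longrightarrow> 0 \<le> (u - v) \<bullet> (x - y)) \<Longrightarrow> (x, u) \<in> G"
  shows "\<exists>x. (x, - x) \<in> G"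
proof -
  have above: "ereal (x \<bullet> u) \<le> fitzpatrick G (x, u)" for x u
  proof (cases "(x, u) \<in> G")
    case True
    then show ?thesis using fitzpatrick_upper[of x u G x u] by simp
  next
    case False
    then obtain y v where yv: "(y, v) \<in> G" "(u - v) \<bullet> (x - y) < 0"
      using max not_le by blast
    then have "x \<bullet> u \<le> x \<bullet> v + y \<bullet> u - y \<bullet> v"
      by (simp add: inner_diff inner_commute)
    then show ?thesis
      using fitzpatrick_upper[OF yv(1)] by (meson ereal_less_eq(3) order_trans)
  qed
  \<comment> \<open>An empty \<open>G\<close> is not maximal: every pair is vacuously related to it.\<close>
  obtain y0 v0 where "(y0, v0) \<in> G"
    using max by blast
  then have "fitzpatrick G (y0, v0) \<noteq> \<infinity>"
    using fitzpatrick_on_graph[OF mono] by force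
  moreover have "fitzpatrick G p \<noteq> -\<infinity>" for p
    using above by (metis MInfty_neq_ereal(1) ereal_infty_less_eq(2) prod.collapse)
  ultimately have "proper_fun (fitzpatrick G)"
    unfolding proper_fun_def by blast
  from resolvent_subdifferential_nonempty[OF this convex_fitzpatrick
      lower_semicontinuous_fitzpatrick zero_less_one, of 0]
  obtain p where p: "- p \<in> subdifferential (fitzpatrick G) p"
    by (metis add.commute add_eq_0_iff scaleR_one)
  obtain x u where xu: "p = (x, u)"
    by (cases p)
  have sub: "fitzpatrick G (x, u) + ereal (- (x, u) \<bullet> (q - (x, u))) \<le> fitzpatrick G q" for q
    using p unfolding xu subdifferential_def by blast
  have key: "(norm (x + u))\<^sup>2 \<le> (- x - v) \<bullet> (- u - y)" if yv: "(y, v) \<in> G" for y v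
  proof -
    have "ereal (x \<bullet> u) + ereal (- (x, u) \<bullet> ((y, v) - (x, u))) \<le> ereal (y \<bullet> v)"
      using add_right_mono[OF above] sub[of "(y, v)"] fitzpatrick_on_graph[OF mono yv]
      by (meson order_trans)
    then have "x \<bullet> u - x \<bullet> (y - x) - u \<bullet> (v - u) \<le> y \<bullet> v"
      by simp
    then show ?thesis
      by (simp add: power2_norm_eq_inner inner_diff inner_add inner_commute)
  qed
  have "(- u, - x) \<in> G"
    using key by (intro max) (meson order_trans zero_le_power2)
  moreover from key[OF this] have "- u = x"
    by (simp add: add_eq_0_iff)
  ultimately show ?thesis by auto
qed

text \<open>
  Scaling by \<open>\<gamma>\<close> and shifting by \<open>w\<close> keep a graph maximally monotone and turn the equation
  \<open>w = z + \<gamma> u\<close> into \<open>- z = \<gamma> u - w\<close>, which asks for a point \<open>(z, - z)\<close> of the transformed graph.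
\<close>

theorem minty:
  fixes M :: "'a::{real_inner,complete_space} \<Rightarrow> 'a set"
  assumes "maximally_monotone M" "\<gamma> > 0"
  shows "\<exists>z. \<exists>u\<in>M z. w = z + \<gamma> *\<^sub>R u"
proof -
  define G where "G = {(x, \<gamma> *\<^sub>R u - w) |x u. u \<in> M x}"
  have "\<exists>x. (x, - x) \<in> G"
  proof (rule minty_graph)
    fix x u y v assume "(x, u) \<in> G" "(y, v) \<in> G"
    then obtain u' v' where uv: "u' \<in> M x" "v' \<in> M y" "u - v = \<gamma> *\<^sub>R (u' - v')"
      by (auto simp: G_def scaleR_diff_right)
    then have "0 \<le> (u' - v') \<bullet> (x - y)"
      using assms(1) by (auto simp: maximally_monotone_def monotone_op_def)
    then show "0 \<le> (u - v) \<bullet> (x - y)"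
      using assms(2) uv(3) by simp
  next
    fix x p assume rel: "\<And>y v. (y, v) \<in> G \<Longrightarrow> 0 \<le> (p - v) \<bullet> (x - y)"
    define u where "u = (1 / \<gamma>) *\<^sub>R (p + w)"
    have p: "p = \<gamma> *\<^sub>R u - w"
      using assms(2) by (simp add: u_def)
    have "u \<in> M x"
    proof (rule maximally_monotone_memberI[OF assms(1)])
      fix y v assume "v \<in> M y"
      then have "0 \<le> (p - (\<gamma> *\<^sub>R v - w)) \<bullet> (x - y)"
        by (intro rel) (auto simp: G_def)
      also have "p - (\<gamma> *\<^sub>R v - w) = \<gamma> *\<^sub>R (u - v)"
        by (simp add: p scaleR_diff_right)
      finally show "0 \<le> (u - v) \<bullet> (x - y)"
        using assms(2) by (simp add: zero_le_mult_iff)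
    qed
    then show "(x, p) \<in> G"
      by (auto simp: G_def p)
  qed
  then obtain z u where u: "u \<in> M z" "- z = \<gamma> *\<^sub>R u - w"
    by (auto simp: G_def)
  have "w = \<gamma> *\<^sub>R u - (\<gamma> *\<^sub>R u - w)"
    by simp
  also have "\<dots> = z + \<gamma> *\<^sub>R u"
    unfolding u(2)[symmetric] by simp
  finally show ?thesis
    using u(1) by blast
qed

section \<open>Resolvents and Euler steps\<close>

lemma mem_resolvent_iff: "z \<in> resolvent \<gamma> M w \<longleftrightarrow> (\<exists>u\<in>M z. w = z + \<gamma> *\<^sub>R u)"
  by (auto simp: resolvent_def op_inverse_def)

lemma resolvent_unique:
  fixes M :: "'a::real_inner \<Rightarrow> 'a set"
  assumes "monotone_op M" "\<gamma> > 0" "z \<in> resolvent \<gamma> M w" "z' \<in> resolvent \<gamma> M w"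
  shows "z = z'"
proof -
  obtain u u' where u: "u \<in> M z" "w = z + \<gamma> *\<^sub>R u" and u': "u' \<in> M z'" "w = z' + \<gamma> *\<^sub>R u'"
    using assms(3,4) unfolding mem_resolvent_iff by blast
  have "z - z' = - (\<gamma> *\<^sub>R (u - u'))"
    using u(2) u'(2) by (simp add: scaleR_diff_right algebra_simps)
  then have "(norm (z - z'))\<^sup>2 = - (\<gamma> * ((u - u') \<bullet> (z - z')))"
    by (metis inner_minus_left inner_scaleR_left power2_norm_eq_inner)
  also have "\<dots> \<le> 0"
    using assms(1,2) u(1) u'(1) by (auto simp: monotone_op_def)
  finally show ?thesis by simp
qed

lemma reflected_resolvent_singleton:
  fixes M :: "'a::real_inner \<Rightarrow> 'a set"
  assumes "monotone_op M" "\<gamma> > 0" and "\<exists>z. \<exists>u\<in>M z. w = z + \<gamma> *\<^sub>R u"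
  shows "\<exists>v. reflected_resolvent \<gamma> M w = {v}"
proof -
  obtain z where "z \<in> resolvent \<gamma> M w"
    using assms(3) by (auto simp: mem_resolvent_iff)
  then have "resolvent \<gamma> M w = {z}"
    using resolvent_unique[OF assms(1,2)] by blast
  then show ?thesis
    by (auto simp: reflected_resolvent_def)
qed

text \<open>
  Both sides are indexed by the points \<open>z\<close> of the resolvent, and with \<open>k = h / \<epsilon>\<close> the relation
  \<open>w = z + k u\<close> turns \<open>z - k u\<close> into \<open>2 z - w\<close>.
\<close>

lemma expl_impl_euler_eq_reflected_resolvent:
  assumes "h / \<epsilon> \<noteq> 0"
  shows "expl_impl_euler h \<epsilon> M = reflected_resolvent (h / \<epsilon>) M"
proof -
  have "(\<exists>u\<in>M z. z = w - k *\<^sub>R u \<and> v = z - k *\<^sub>R u)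
      \<longleftrightarrow> v = 2 *\<^sub>R z - w \<and> (\<exists>u\<in>M z. w = z + k *\<^sub>R u)" for k :: real and z w v
    by (auto simp: scaleR_2 algebra_simps)
  then show ?thesis
    unfolding expl_impl_euler_def reflected_resolvent_def impl_euler_def fun_eq_iff set_eq_iff
    by (auto simp: mem_resolvent_iff)
qed

lemma expl_impl_euler_subset: "expl_impl_euler h \<epsilon> M w \<subseteq> (expl_euler h \<epsilon> M \<circ>\<^sub>s impl_euler h \<epsilon> M) w"
  by (auto simp: expl_impl_euler_def op_comp_def expl_euler_def)

text \<open>The direction of the explicit step is forced to be the one found by the implicit step.\<close>

lemma euler_comp_single_valued:
  assumes "at_most_single_valued M"
  shows "expl_euler h \<epsilon> M \<circ>\<^sub>s impl_euler h \<epsilon> M = expl_impl_euler h \<epsilon> M"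
proof (intro ext equalityI subsetI)
  fix w v assume "v \<in> (expl_euler h \<epsilon> M \<circ>\<^sub>s impl_euler h \<epsilon> M) w"
  then obtain z u where z: "z \<in> impl_euler h \<epsilon> M w" and u: "u \<in> M z" "v = z - (h / \<epsilon>) *\<^sub>R u"
    by (auto simp: op_comp_def expl_euler_def)
  from z obtain u' where u': "u' \<in> M z" "w = z + (h / \<epsilon>) *\<^sub>R u'"
    by (auto simp: impl_euler_def mem_resolvent_iff)
  have "u' = u"
    using assms u(1) u'(1) by (auto simp: at_most_single_valued_def)
  then show "v \<in> expl_impl_euler h \<epsilon> M w"
    unfolding expl_impl_euler_def mem_Collect_eq
    using z u u' by (intro bexI[of _ z] bexI[of _ u]) auto
qed (use expl_impl_euler_subset in blast)

lemma op_comp_assoc: "(F \<circ>\<^sub>s G) \<circ>\<^sub>s H = F \<circ>\<^sub>s G \<circ>\<^sub>s H"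
  by (auto simp: op_comp_def fun_eq_iff)

lemma update_sequences_singleton:
  assumes "\<And>w. \<exists>v. F w = {v}"
  shows "\<exists>ws. update_sequences F start = {ws}"
proof -
  obtain f where f: "\<And>w. F w = {f w}"
    using assms by metis
  have "ws = (\<lambda>n. (f ^^ n) start)" if "ws 0 = start" "\<And>n. ws (Suc n) = f (ws n)" for ws
  proof
    show "ws n = (f ^^ n) start" for n
      by (induction n) (simp_all add: that)
  qed
  then have "update_sequences F start = {\<lambda>n. (f ^^ n) start}"
    by (auto simp: update_sequences_def f)
  then show ?thesis by blast
qed

theorem theorem5p3:
  fixes D :: "'w::{real_inner, complete_space} set"
    and A :: "'w \<Rightarrow> 'w"
    and b w0 :: 'w
    and g :: "'w \<Rightarrow> ereal"
    and S A\<^sub>b \<psi>1e \<psi>1i \<psi>2e \<psi>2i \<psi>2ei :: "'w \<Rightarrow> 'w set"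
    and h \<epsilon> \<gamma> :: real
  assumes "h > 0" and "\<epsilon> > 0" and "\<gamma> = h / \<epsilon>"
    and "maximally_monotone (op_on D A)"
    and "proper_fun g" and "convex_fun g" and "lower_semicontinuous g"
    and "S = subdifferential g"
    and "A\<^sub>b = op_on D (\<lambda>w. A w + b)"
    and "\<psi>1e = expl_euler h \<epsilon> A\<^sub>b" and "\<psi>1i = impl_euler h \<epsilon> A\<^sub>b"
    and "\<psi>2e = expl_euler h \<epsilon> S" and "\<psi>2i = impl_euler h \<epsilon> S"
    and "\<psi>2ei = expl_impl_euler h \<epsilon> S"
  shows
    "(\<forall>w. \<exists>v. (\<psi>2ei \<circ>\<^sub>s \<psi>1e \<circ>\<^sub>s \<psi>1i) w = {v} \<and>
              (reflected_resolvent \<gamma> S \<circ>\<^sub>s reflected_resolvent \<gamma> A\<^sub>b) w = {v}) \<and>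
     (\<exists>ws. update_sequences (\<psi>2ei \<circ>\<^sub>s \<psi>1e \<circ>\<^sub>s \<psi>1i) w0 = {ws} \<and>
           update_sequences (reflected_resolvent \<gamma> S \<circ>\<^sub>s reflected_resolvent \<gamma> A\<^sub>b) w0 = {ws}) \<and>
     (\<forall>w. (reflected_resolvent \<gamma> S \<circ>\<^sub>s reflected_resolvent \<gamma> A\<^sub>b) w
            \<subseteq> (\<psi>2e \<circ>\<^sub>s \<psi>2i \<circ>\<^sub>s \<psi>1e \<circ>\<^sub>s \<psi>1i) w) \<and>
     (at_most_single_valued S \<longrightarrow>
        (\<forall>w. (\<psi>2e \<circ>\<^sub>s \<psi>2i \<circ>\<^sub>s \<psi>1e \<circ>\<^sub>s \<psi>1i) w
               = (reflected_resolvent \<gamma> S \<circ>\<^sub>s reflected_resolvent \<gamma> A\<^sub>b) w) \<and>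
        update_sequences (\<psi>2e \<circ>\<^sub>s \<psi>2i \<circ>\<^sub>s \<psi>1e \<circ>\<^sub>s \<psi>1i) w0
          = update_sequences (reflected_resolvent \<gamma> S \<circ>\<^sub>s reflected_resolvent \<gamma> A\<^sub>b) w0)"
proof -
  have \<gamma>: "\<gamma> > 0" "h / \<epsilon> = \<gamma>" "h / \<epsilon> \<noteq> 0"
    using assms(1-3) by auto
  let ?RS = "reflected_resolvent \<gamma> S" and ?RA = "reflected_resolvent \<gamma> A\<^sub>b"
  have "monotone_op (op_on D A)"
    using assms(4) by (simp add: maximally_monotone_def)
  then have mono_A: "monotone_op A\<^sub>b"
    unfolding assms(9) monotone_op_def op_on_def by (simp split: if_splits)
  have surj_A: "\<exists>z. \<exists>u\<in>A\<^sub>b z. w = z + \<gamma> *\<^sub>R u" for w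
  proof -
    \<comment> \<open>The constant \<open>b\<close> is moved to the right-hand side of the resolvent equation.\<close>
    obtain z u where "u \<in> op_on D A z" "w - \<gamma> *\<^sub>R b = z + \<gamma> *\<^sub>R u"
      using minty[OF assms(4) \<gamma>(1)] by blast
    then show ?thesis
      unfolding assms(9) op_on_def
      by (auto simp: algebra_simps split: if_splits intro!: exI[of _ z])
  qed
  have RA: "\<exists>v. ?RA w = {v}" for w
    by (rule reflected_resolvent_singleton[OF mono_A \<gamma>(1) surj_A])
  have RS: "\<exists>v. ?RS w = {v}" for w
    unfolding assms(8)
    by (rule reflected_resolvent_singleton[OF monotone_subdifferential[OF assms(5)] \<gamma>(1)
          resolvent_subdifferential_nonempty[OF assms(5-7) \<gamma>(1)]])
  have R: "\<exists>v. (?RS \<circ>\<^sub>s ?RA) w = {v}" for w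
    using RA[of w] RS by (auto simp: op_comp_def)
  have "at_most_single_valued A\<^sub>b"
    by (simp add: assms(9) at_most_single_valued_def op_on_def)
  then have euler_A: "\<psi>1e \<circ>\<^sub>s \<psi>1i = ?RA"
    unfolding assms(10,11)
    by (simp add: euler_comp_single_valued expl_impl_euler_eq_reflected_resolvent[OF \<gamma>(3)] \<gamma>(2))
  have euler_S: "\<psi>2ei = ?RS"
    using expl_impl_euler_eq_reflected_resolvent[OF \<gamma>(3)] by (simp add: assms(14) \<gamma>(2))
  have sub: "?RS w \<subseteq> (\<psi>2e \<circ>\<^sub>s \<psi>2i) w" for w
    using expl_impl_euler_subset[of h \<epsilon> S w] euler_S by (simp add: assms(12-14))
  have unrestricted: "(?RS \<circ>\<^sub>s ?RA) w \<subseteq> ((\<psi>2e \<circ>\<^sub>s \<psi>2i) \<circ>\<^sub>s ?RA) w" for w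
    unfolding op_comp_def[of _ ?RA] using sub by blast
  have single: "\<psi>2e \<circ>\<^sub>s \<psi>2i = ?RS" if "at_most_single_valued S"
    using euler_comp_single_valued[OF that, of h \<epsilon>] euler_S by (simp add: assms(12-14))
  show ?thesis
    unfolding euler_A euler_S op_comp_assoc[symmetric, of \<psi>2e]
    using R update_sequences_singleton[OF R, where start = w0] unrestricted single by auto
qed

end
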